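(* There is a randomized algorithm that, given {\textsc{SET-EVAL}} access to two distributions $D$ and $D'$ on $[n]$, makes at most two queries to each of $D$ and $D'$, always accepts if $D=D'$, and rejects with probability at least $3/4$ if $D\neq D'$.
   Context: For a distribution $D$ on $[n]=\{1,\dots,n\}$ and $S\subseteq[n]$, $D(S)=\sum_{i\in S}D(i)$. A {\textsc{SET-EVAL}} oracle for $D$ takes as input any set $S\subseteq[n]$ and returns $D(S)$. *)

theory Defs
  imports "HOL-Probability.Probability"
begin

definition distribution_on :: "nat \<Rightarrow> nat pmf \<Rightarrow> bool" where
  "distribution_on n D \<longleftrightarrow> set_pmf D \<subseteq> {1..n}"

definition set_eval :: "nat pmf \<Rightarrow> nat set \<Rightarrow> real" where
  "set_eval D S = (\<Sum>i\<in>S. pmf D i)"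

datatype verdict = Accept | Reject

datatype oracle_name = First | Second

text \<open>
  A randomized algorithm with two set oracles, in the query model: it halts with a verdict, or tosses
  a fair coin and continues according to the outcome, or sends a set to one of the oracles and
  continues according to the real number it receives. Queries may depend on earlier coin tosses and
  answers. As this is a datatype, every branch is finite.
\<close>

datatype query_alg =
    Halt verdict
  | Toss "bool \<Rightarrow> query_alg"
  | Query oracle_name "nat set" "real \<Rightarrow> query_alg"

text \<open>
  The joint distribution, over the coin tosses, of the verdict and of the list of all queries made
  (repeated queries are listed repeatedly), when the two oracles answer by \<open>f\<close> and \<open>g\<close>. The
  algorithm depends on the oracles only through their answers.
\<close>

primrec run :: "(nat set \<Rightarrow> real) \<Rightarrow> (nat set \<Rightarrow> real) \<Rightarrow> query_alg
    \<Rightarrow> (verdict \<times> (oracle_name \<times> nat set) list) pmf" where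
  "run f g (Halt v) = return_pmf (v, [])"
| "run f g (Toss k) = bind_pmf (bernoulli_pmf (1/2)) (\<lambda>b. run f g (k b))"
| "run f g (Query w S k) =
     map_pmf (\<lambda>(v, qs). (v, (w, S) # qs))
       (run f g (k (case w of First \<Rightarrow> f S | Second \<Rightarrow> g S)))"

definition run_set_eval :: "nat pmf \<Rightarrow> nat pmf \<Rightarrow> query_alg
    \<Rightarrow> (verdict \<times> (oracle_name \<times> nat set) list) pmf" where
  "run_set_eval D D' A = run (set_eval D) (set_eval D') A"

definition num_queries :: "oracle_name \<Rightarrow> (oracle_name \<times> nat set) list \<Rightarrow> nat" where
  "num_queries w qs = length (filter (\<lambda>q. fst q = w) qs)"

end

theory Submission
  imports Defs
begin

text \<open>
  Query both oracles on two independent uniformly random subsets of \<open>[n]\<close> and accept iff they agree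
  on both. If \<open>D\<close> and \<open>D'\<close> differ at a point \<open>i\<close>, then for each pair \<open>T\<close>, \<open>T \<union> {i}\<close> with
  \<open>i \<notin> T\<close> at most one of the two sets has \<open>D\<close>- and \<open>D'\<close>-mass equal, so one random set fails to
  separate the distributions with probability at most \<open>1/2\<close>, and two with probability at most \<open>1/4\<close>.
\<close>

primrec random_subset :: "nat \<Rightarrow> nat set pmf" where
  "random_subset 0 = return_pmf {}"
| "random_subset (Suc m) = bind_pmf (bernoulli_pmf (1/2)) (\<lambda>b.
     map_pmf (\<lambda>T. if b then insert (Suc m) T else T) (random_subset m))"

text \<open>Continuation-passing style is needed because a \<open>query_alg\<close> can only halt
  with a verdict, so the sampled set is handed to \<open>k\<close> instead of being
  returned.\<close>

primrec with_random_subset :: "nat \<Rightarrow> (nat set \<Rightarrow> query_alg) \<Rightarrow> query_alg" where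
  "with_random_subset 0 k = k {}"
| "with_random_subset (Suc m) k =
     Toss (\<lambda>b. with_random_subset m (\<lambda>T. k (if b then insert (Suc m) T else T)))"

lemma run_with_random_subset:
  "run f g (with_random_subset m k) = bind_pmf (random_subset m) (\<lambda>T. run f g (k T))"
  by (induction m arbitrary: k)
    (simp_all add: bind_return_pmf bind_assoc_pmf bind_map_pmf)

lemma random_subset_subset: "T \<in> set_pmf (random_subset m) \<Longrightarrow> T \<subseteq> {1..m}"
proof (induction m arbitrary: T)
  case 0
  then show ?case by simp
next
  case (Suc m)
  then obtain T' where "T' \<in> set_pmf (random_subset m)" "T \<subseteq> insert (Suc m) T'"
    by (auto split: if_splits)
  with Suc.IH show ?case by fastforce
qed

lemma prob_bind_fair_coin:
  "measure_pmf.prob (bind_pmf (bernoulli_pmf (1/2)) M) A =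
    (measure_pmf.prob (M True) A + measure_pmf.prob (M False) A) / 2"
proof -
  have "measure_pmf.prob (bind_pmf (bernoulli_pmf (1/2)) M) A =
      measure_pmf.expectation (bernoulli_pmf (1/2)) (\<lambda>b. measure_pmf.prob (M b) A)"
    unfolding measure_pmf_bind
    using measurable_measure_pmf[of M]
    by (subst measure_pmf.measure_bind[where N = "count_space UNIV"]) auto
  then show ?thesis by simp
qed

text \<open>
  The target value \<open>c\<close> is arbitrary because the induction removes the last element, which
  shifts the target when \<open>d (Suc m) \<noteq> 0\<close>.
\<close>

lemma random_subset_sum_eq_le_half:
  fixes d :: "nat \<Rightarrow> real"
  assumes "i \<in> {1..m}" "d i \<noteq> 0"
  shows "measure_pmf.prob (random_subset m) {T. sum d T = c} \<le> 1/2"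
  using assms
proof (induction m arbitrary: i c)
  case 0
  then show ?case by simp
next
  case (Suc m)
  let ?P = "measure_pmf.prob (random_subset m)"
  \<comment> \<open>The two events may differ as sets; they agree on the support, where
    \<open>T\<close> is finite and omits \<open>Suc m\<close>.\<close>
  have shift: "?P {T. sum d (insert (Suc m) T) = c} = ?P {T. sum d T = c - d (Suc m)}"
  proof (rule measure_pmf.finite_measure_eq_AE)
    show "AE T in measure_pmf (random_subset m).
        T \<in> {T. sum d (insert (Suc m) T) = c} \<longleftrightarrow> T \<in> {T. sum d T = c - d (Suc m)}"
    proof (rule AE_pmfI)
      fix T assume "T \<in> set_pmf (random_subset m)"
      then have "T \<subseteq> {1..m}" by (rule random_subset_subset)
      then have "finite T" "Suc m \<notin> T" by (auto intro: finite_subset)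
      then show "T \<in> {T. sum d (insert (Suc m) T) = c} \<longleftrightarrow> T \<in> {T. sum d T = c - d (Suc m)}"
        by auto
    qed
  qed simp_all
  have split: "measure_pmf.prob (random_subset (Suc m)) {T. sum d T = c} =
      (?P {T. sum d T = c - d (Suc m)} + ?P {T. sum d T = c}) / 2"
    by (simp add: prob_bind_fair_coin vimage_def shift)
  show ?case
  proof (cases "d (Suc m) = 0")
    case True
    \<comment> \<open>Both events in \<open>split\<close> coincide here, so the average is bounded
      by the induction hypothesis.\<close>
    with Suc.prems have "i \<in> {1..m}" by (cases "i = Suc m") auto
    from Suc.IH[OF this Suc.prems(2)] show ?thesis
      unfolding split by (simp add: True)
  next
    case False
    \<comment> \<open>The two targets are distinct, so the events are disjoint and their
      probabilities add up to at most 1.\<close>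
    have "?P {T. sum d T = c - d (Suc m)} + ?P {T. sum d T = c} =
        ?P ({T. sum d T = c - d (Suc m)} \<union> {T. sum d T = c})"
      using False by (subst measure_pmf.finite_measure_Union) auto
    also have "\<dots> \<le> 1" by simp
    finally show ?thesis unfolding split by simp
  qed
qed

lemma distribution_on_neq_imp_pmf_neq:
  assumes "distribution_on n D" "distribution_on n D'" "D \<noteq> D'"
  obtains i where "i \<in> {1..n}" "pmf D i \<noteq> pmf D' i"
proof -
  obtain i where i: "pmf D i \<noteq> pmf D' i"
    using \<open>D \<noteq> D'\<close> by (auto simp: pmf_eq_iff)
  then have "i \<in> set_pmf D \<or> i \<in> set_pmf D'"
    by (auto simp: set_pmf_iff)
  then have "i \<in> {1..n}"
    using assms(1,2) unfolding distribution_on_def by blast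
  with i show thesis by (rule that[rotated])
qed

text \<open>Both sets are drawn before the first query, so a run is an image of the product
  distribution of two independent random subsets.\<close>

definition equality_tester :: "nat \<Rightarrow> query_alg" where
  "equality_tester n = with_random_subset n (\<lambda>S. with_random_subset n (\<lambda>T.
     Query First S (\<lambda>a. Query Second S (\<lambda>b. Query First T (\<lambda>a'. Query Second T (\<lambda>b'.
       Halt (if a = b \<and> a' = b' then Accept else Reject)))))))"

lemma run_equality_tester:
  "run f g (equality_tester n) =
    map_pmf (\<lambda>(S, T). (if f S = g S \<and> f T = g T then Accept else Reject,
        [(First, S), (Second, S), (First, T), (Second, T)]))
      (pair_pmf (random_subset n) (random_subset n))"
  by (simp only: equality_tester_def run_with_random_subset pair_pmf_def map_bind_pmf
      map_return_pmf run.simps prod.case oracle_name.case)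

lemma equality_tester_rejects:
  assumes "distribution_on n D" "distribution_on n D'" "D \<noteq> D'"
  shows "measure_pmf.prob (run_set_eval D D' (equality_tester n)) {(v, qs). v = Reject} \<ge> 3/4"
proof -
  let ?R = "random_subset n"
  define E where "E = {T. set_eval D T = set_eval D' T}"
  obtain i where i: "i \<in> {1..n}" "pmf D i - pmf D' i \<noteq> 0"
    using distribution_on_neq_imp_pmf_neq[OF assms] by (metis eq_iff_diff_eq_0)
  \<comment> \<open>By linearity, agreement on \<open>T\<close> is a vanishing sum of differences,
    which is the target value \<open>c = 0\<close>.\<close>
  have "E = {T. (\<Sum>j\<in>T. pmf D j - pmf D' j) = 0}"
    by (auto simp: E_def set_eval_def sum_subtractf)
  then have E_le: "measure_pmf.prob ?R E \<le> 1/2"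
    using random_subset_sum_eq_le_half[where d = "\<lambda>j. pmf D j - pmf D' j", OF i] by simp
  \<comment> \<open>The product rule \<open>measure_pmf_prob_product\<close> asks for countable
    sets. \<open>E\<close> is uncountable, since sums over infinite sets are 0 by convention, so it
    is first cut down to the countable support.\<close>
  have "measure_pmf.prob (pair_pmf ?R ?R) (E \<times> E) =
      measure_pmf.prob (pair_pmf ?R ?R) ((E \<inter> set_pmf ?R) \<times> (E \<inter> set_pmf ?R))"
    by (subst measure_Int_set_pmf[symmetric]) (simp add: Times_Int_Times)
  also have "\<dots> = measure_pmf.prob ?R E * measure_pmf.prob ?R E"
    by (subst measure_pmf_prob_product) (simp_all add: measure_Int_set_pmf)
  also have "\<dots> \<le> 1/2 * (1/2)"
    using E_le by (intro mult_mono) auto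
  finally have accept: "measure_pmf.prob (pair_pmf ?R ?R) (E \<times> E) \<le> 1/4" by simp
  have "measure_pmf.prob (run_set_eval D D' (equality_tester n)) {(v, qs). v = Reject} =
      measure_pmf.prob (pair_pmf ?R ?R) (- (E \<times> E))"
    unfolding run_set_eval_def run_equality_tester measure_map_pmf
    by (rule arg_cong[where f = "measure_pmf.prob (pair_pmf ?R ?R)"])
      (auto simp: E_def split: if_splits)
  also have "\<dots> = 1 - measure_pmf.prob (pair_pmf ?R ?R) (E \<times> E)"
    using measure_pmf.prob_compl[of "E \<times> E" "pair_pmf ?R ?R"] by (simp add: Compl_eq_Diff_UNIV)
  finally show ?thesis using accept by simp
qed

theorem theorem4p1:
  "\<exists>A :: nat \<Rightarrow> query_alg. \<forall>(n::nat) (D::nat pmf) (D'::nat pmf).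
     distribution_on n D \<longrightarrow> distribution_on n D' \<longrightarrow>
       (\<forall>(v, qs) \<in> set_pmf (run_set_eval D D' (A n)).
          (\<forall>(w, S) \<in> set qs. S \<subseteq> {1..n}) \<and>
          num_queries First qs \<le> 2 \<and> num_queries Second qs \<le> 2) \<and>
       (D = D' \<longrightarrow> (\<forall>(v, qs) \<in> set_pmf (run_set_eval D D' (A n)). v = Accept)) \<and>
       (D \<noteq> D' \<longrightarrow>
          measure_pmf.prob (run_set_eval D D' (A n)) {(v, qs). v = Reject} \<ge> 3/4)"
proof (intro exI[of _ equality_tester] allI impI conjI)
  fix n D D'
  show "\<forall>(v, qs) \<in> set_pmf (run_set_eval D D' (equality_tester n)).
      (\<forall>(w, S) \<in> set qs. S \<subseteq> {1..n}) \<and>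
      num_queries First qs \<le> 2 \<and> num_queries Second qs \<le> 2"
    unfolding run_set_eval_def run_equality_tester
    by (auto simp: num_queries_def simp del: atLeastAtMost_iff dest!: random_subset_subset)
  \<comment> \<open>With \<open>D = D'\<close> both oracles are the same function, so the test
    passes for every outcome of the coins.\<close>
  show "\<forall>(v, qs) \<in> set_pmf (run_set_eval D D' (equality_tester n)). v = Accept" if "D = D'"
    unfolding run_set_eval_def run_equality_tester using that by auto
  show "measure_pmf.prob (run_set_eval D D' (equality_tester n)) {(v, qs). v = Reject} \<ge> 3/4"
    if "distribution_on n D" "distribution_on n D'" "D \<noteq> D'"
    using that by (rule equality_tester_rejects)
qed

end
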